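(* Let $B\in \mathbb{R}^{m\times n}$ be a matrix with nonnegative entries and without zero rows or zero columns, and let $x\in \mathbb{R}^n$ and $y\in \mathbb{R}^m$ be vectors with strictly positive entries. Let $R\in\mathbb{R}^{m\times m}$ and $C\in\mathbb{R}^{n\times n}$ be diagonal matrices such that $Bx=Ry$ and $y^{\top}B = x^{\top} C$. Then for all $S\subseteq \{1,\dots,m\}$ and $T\subseteq \{1,\dots,n\}$, $$\left|\langle\chi_S,B\chi_T\rangle - \frac{\langle \chi_S,Bx\rangle \langle y,B\chi_T\rangle}{\langle y,Bx\rangle}\right| \le \sigma_2(R^{-1/2}BC^{-1/2})\sqrt{\left(\|R^{1/2}\chi_S\|^2-\frac{\langle \chi_S,Bx\rangle^2}{\langle y,Bx\rangle} \right) \left( \|C^{1/2}\chi_T\|^2-\frac{\langle y,B\chi_T\rangle^2}{\langle y,Bx\rangle}\right)},$$ where $\sigma_2(R^{-1/2}BC^{-1/2})$ denotes the second largest singular value of $R^{-1/2}BC^{-1/2}$.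
   Context: $\chi_S\in\{0,1\}^m$ and $\chi_T\in\{0,1\}^n$ denote the characteristic vectors of $S$ and $T$; $\langle\cdot,\cdot\rangle$ is the standard inner product and $\|\cdot\|$ the Euclidean norm. The diagonal entries of $R$ and $C$ are automatically positive. Singular values are counted with multiplicity; if $\min(m,n)=1$, the second largest singular value is taken to be $0$. *)

theory Defs
  imports
    "HOL-Analysis.Analysis"
    "HOL-Computational_Algebra.Polynomial"
    "HOL-Library.Multiset"
begin

definition char_vec :: "'n set \<Rightarrow> real ^ 'n" where
  "char_vec S = (\<chi> i. if i \<in> S then 1 else 0)"

definition diagonal_matrix :: "real ^ 'n ^ 'n \<Rightarrow> bool" where
  "diagonal_matrix D \<longleftrightarrow> (\<forall>i j. i \<noteq> j \<longrightarrow> D $ i $ j = 0)"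

(* The real power D^a of a diagonal matrix D with positive diagonal;
   not meaningful for other matrices. *)
definition diag_powr :: "real ^ 'n ^ 'n \<Rightarrow> real \<Rightarrow> real ^ 'n ^ 'n" where
  "diag_powr D a = (\<chi> i j. if i = j then (D $ i $ i) powr a else 0)"

definition charpoly :: "real ^ 'n ^ 'n \<Rightarrow> real poly" where
  "charpoly A = det (mat [:0, 1:] - map_matrix (\<lambda>a. [:a:]) A)"

(* The singular values of A with multiplicity: the square roots of the
   eigenvalues (roots of the characteristic polynomial with their algebraic
   multiplicities) of the Gram matrix of smaller size.  As that matrix is
   symmetric positive semidefinite, all its eigenvalues are real and nonnegative,
   so an m x n matrix has exactly min m n singular values. *)
definition singular_values :: "real ^ 'n ^ 'm \<Rightarrow> real multiset" where
  "singular_values A = image_mset sqrt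
     (if CARD('n) \<le> CARD('m) then proots (charpoly (transpose A ** A))
      else proots (charpoly (A ** transpose A)))"

definition second_singular_value :: "real ^ 'n ^ 'm \<Rightarrow> real" where
  "second_singular_value A =
     (let s = rev (sorted_list_of_multiset (singular_values A))
      in if 2 \<le> length s then s ! 1 else 0)"

end

theory Submission
  imports Defs
begin

text \<open>Put \<open>A = R^(-1/2) B C^(-1/2)\<close>, \<open>u = R^(1/2) y\<close> and \<open>v = C^(1/2) x\<close>. Then \<open>A v = u\<close> and \<open>u A = v\<close>, so \<open>A\<close>
has the singular value \<open>1\<close>, and since \<open>A\<close> is nonnegative and \<open>v\<close> positive, Schur's test shows
that \<open>A\<close> is a contraction. The deviation to be bounded is \<open>\<langle>g, A f\<rangle>\<close>, where \<open>g\<close> and \<open>f\<close> are the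
components of \<open>R^(1/2) \<chi>\<^sub>S\<close> and \<open>C^(1/2) \<chi>\<^sub>T\<close> orthogonal to \<open>u\<close> and \<open>v\<close>, and on these orthogonal complements
\<open>A\<close> and its transpose are bounded by the second singular value. For the latter it suffices that
the maximum \<open>\<mu> \<le> 1\<close> of the quadratic form of the Gram matrix on the unit sphere of the complement is
an eigenvalue with an eigenvector orthogonal to the one for \<open>1\<close>: then \<open>(X - 1) (X - \<mu>)\<close> divides the
characteristic polynomial, even if \<open>\<mu> = 1\<close>, and the second largest root is at least \<open>\<mu>\<close>.\<close>

section \<open>Characteristic polynomials and independent eigenvectors\<close>

lemma const_poly_sum: "[:sum f A:] = (\<Sum>a\<in>A. [:f a:])"
  by (rule poly_eqI) (simp add: coeff_sum coeff_pCons split: nat.split)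

lemma map_matrix_const_poly_mult:
  fixes A :: "'a::comm_ring_1 ^ 'n ^ 'm" and B :: "'a ^ 'p ^ 'n"
  shows "map_matrix (\<lambda>a. [:a:]) A ** map_matrix (\<lambda>a. [:a:]) B = map_matrix (\<lambda>a. [:a:]) (A ** B)"
  by (simp add: vec_eq_iff matrix_matrix_mult_def const_poly_sum mult.commute)

lemma poly_det:
  fixes A :: "'a::comm_ring_1 poly ^ 'n ^ 'n"
  shows "poly (det A) t = det (map_matrix (\<lambda>p. poly p t) A)"
  by (simp add: det_def poly_sum poly_prod)

lemma poly_charpoly: "poly (charpoly A) t = det (mat t - A)"
  unfolding charpoly_def poly_det
  by (rule arg_cong[where f = det]) (simp add: vec_eq_iff mat_def)

lemma mat_mult_vector: "mat t *v z = t *\<^sub>R (z :: real ^ 'n)"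
  by (simp add: vec_eq_iff matrix_vector_mult_def mat_def if_distrib if_distribR cong: if_cong)

text \<open>A number above an operator norm bound of \<open>A\<close> is no eigenvalue, hence no
  root. Nonvanishing lets \<open>proots\<close> turn products into multiset sums.\<close>

lemma charpoly_nonzero: "charpoly A \<noteq> 0"
proof -
  obtain K where K: "norm (A *v z) \<le> K * norm z" for z
    using linear_bounded[OF matrix_vector_mul_linear[of A]] by metis
  define t where "t = \<bar>K\<bar> + 1"
  have "z = 0" if "(mat t - A) *v z = 0" for z
  proof (rule ccontr)
    assume "z \<noteq> 0"
    have "t *\<^sub>R z = A *v z"
      using that by (simp add: matrix_vector_mult_diff_rdistrib mat_mult_vector)
    then have "t * norm z \<le> K * norm z"
      using K[of z] by (metis norm_scaleR abs_of_nonneg t_def abs_ge_zero add_nonneg_nonneg zero_le_one)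
    with \<open>z \<noteq> 0\<close> show False
      by (simp add: t_def)
  qed
  then have "invertible (mat t - A)"
    by (metis invertible_left_inverse matrix_left_invertible_ker)
  then have "poly (charpoly A) t \<noteq> 0"
    by (simp add: poly_charpoly invertible_det_nz)
  then show ?thesis
    by auto
qed

text \<open>Divisibility by the product, unlike the mere existence of two roots, records a double
  root when \<open>\<alpha> = \<beta>\<close>. The nonzero minor encodes linear independence of
  \<open>v\<close> and \<open>w\<close>.\<close>

lemma two_eigenvectors_dvd_charpoly:
  fixes M :: "real ^ 'n ^ 'n"
  assumes v: "M *v v = \<alpha> *\<^sub>R v" and w: "M *v w = \<beta> *\<^sub>R w"
    and minor: "v $ k * w $ l \<noteq> v $ l * w $ k"
  shows "[:- \<alpha>, 1:] * [:- \<beta>, 1:] dvd charpoly M"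
proof -
  \<comment> \<open>\<open>Q\<close> is the identity with columns \<open>k\<close> and \<open>l\<close> replaced by \<open>v\<close> and \<open>w\<close>; the minor makes it invertible,
    and these columns of \<open>(X - M) Q\<close> carry the factors \<open>X - \<alpha>\<close> and \<open>X - \<beta>\<close>.\<close>
  have "k \<noteq> l"
    using minor by auto
  define Q :: "real ^ 'n ^ 'n" where
    "Q = (\<chi> i j. if j = k then v $ i else if j = l then w $ i else if j = i then 1 else 0)"
  have "z = 0" if "Q *v z = 0" for z
  proof -
    have eq: "v $ i * z $ k + w $ i * z $ l + (if i = k \<or> i = l then 0 else z $ i) = 0" for i
    proof -
      have "0 = (\<Sum>j\<in>UNIV. Q $ i $ j * z $ j)"
        using that by (simp add: vec_eq_iff matrix_vector_mult_def)
      also have "\<dots> = (\<Sum>j\<in>UNIV. (if j = k then v $ i * z $ k else 0) + (if j = l then w $ i * z $ l else 0)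
          + (if j = i then (if i = k \<or> i = l then 0 else z $ i) else 0))"
        by (rule sum.cong) (use \<open>k \<noteq> l\<close> in \<open>auto simp: Q_def\<close>)
      finally show ?thesis
        by (simp add: sum.distrib)
    qed
    \<comment> \<open>Rows \<open>k\<close> and \<open>l\<close> form a 2x2 system for
      \<open>z $ k\<close> and \<open>z $ l\<close> whose determinant is the given minor; after that
      the other rows read \<open>z $ i = 0\<close>.\<close>
    have k: "v $ k * z $ k + w $ k * z $ l = 0" and l: "v $ l * z $ k + w $ l * z $ l = 0"
      using eq[of k] eq[of l] by auto
    have "(v $ k * w $ l - v $ l * w $ k) * z $ k = 0" "(v $ k * w $ l - v $ l * w $ k) * z $ l = 0"
      using k l by algebra+
    then have "z $ k = 0" "z $ l = 0"
      using minor by auto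
    then have "z $ i = 0" for i
      using eq[of i] by (cases "i = k \<or> i = l") auto
    then show "z = 0"
      by (simp add: vec_eq_iff)
  qed
  then obtain L where L: "L ** Q = mat 1"
    by (metis matrix_left_invertible_ker)
  define Qp where "Qp = map_matrix (\<lambda>a. [:a:]) Q"
  define Lp where "Lp = map_matrix (\<lambda>a. [:a:]) L"
  define N where "N = mat [:0, 1:] - map_matrix (\<lambda>a. [:a:]) M"
  \<comment> \<open>\<open>Z\<close> is \<open>N ** Qp\<close> with the eigenvalue factors stripped
    from columns \<open>k\<close> and \<open>l\<close>; the diagonal matrix \<open>D\<close>
    restores them.\<close>
  define Z where "Z = (\<chi> i j. if j = k \<or> j = l then [:Q $ i $ j:] else (N ** Qp) $ i $ j)"
  define D :: "real poly ^ 'n ^ 'n" where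
    "D = (\<chi> i j. if i = j then if j = k then [:- \<alpha>, 1:] else if j = l then [:- \<beta>, 1:] else 1 else 0)"
  have "Lp ** Qp = mat 1"
    unfolding Lp_def Qp_def map_matrix_const_poly_mult L
    by (simp add: vec_eq_iff mat_def)
  then have "det Lp * det Qp = 1"
    by (metis det_I det_mul)
  have entry: "(N ** Qp) $ i $ j = [:0, 1:] * [:Q $ i $ j:] - [:(M *v column j Q) $ i:]" for i j
  proof -
    have "(N ** Qp) $ i $ j
        = (\<Sum>a\<in>UNIV. (if a = i then [:0, 1:] * [:Q $ i $ j:] else 0) - [:M $ i $ a * Q $ a $ j:])"
      unfolding matrix_matrix_mult_def vec_lambda_beta
      by (rule sum.cong) (auto simp: N_def Qp_def mat_def)
    then show ?thesis
      by (simp add: sum_subtractf const_poly_sum matrix_vector_mult_def column_def)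
  qed
  have "N ** Qp = Z ** D"
  proof -
    have "column k Q = v" "column l Q = w"
      using \<open>k \<noteq> l\<close> by (auto simp: Q_def column_def vec_eq_iff)
    then have cols: "(N ** Qp) $ i $ k = Z $ i $ k * [:- \<alpha>, 1:]" "(N ** Qp) $ i $ l = Z $ i $ l * [:- \<beta>, 1:]" for i
      using \<open>k \<noteq> l\<close> by (simp_all add: entry v w Z_def Q_def)
    have "(N ** Qp) $ i $ j = Z $ i $ j * D $ j $ j" for i j
    proof (cases "j = k \<or> j = l")
      case True
      then show ?thesis
        using cols[of i] \<open>k \<noteq> l\<close>
        by (auto simp: D_def simp del: mult_pCons_left mult_pCons_right)
    qed (simp add: D_def Z_def)
    moreover have "(Z ** D) $ i $ j = Z $ i $ j * D $ j $ j" for i j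
    proof -
      have "(Z ** D) $ i $ j = (\<Sum>a\<in>UNIV. if a = j then Z $ i $ j * D $ j $ j else 0)"
        unfolding matrix_matrix_mult_def vec_lambda_beta by (rule sum.cong) (auto simp: D_def)
      then show ?thesis
        by simp
    qed
    ultimately show ?thesis
      by (simp add: vec_eq_iff)
  qed
  have "det D = (\<Prod>j\<in>UNIV. D $ j $ j)"
    by (rule det_diagonal) (simp add: D_def)
  then have "(\<Prod>j\<in>{k, l}. D $ j $ j) dvd det D"
    by (simp only: prod_dvd_prod_subset[of UNIV] finite subset_UNIV)
  then have "[:- \<alpha>, 1:] * [:- \<beta>, 1:] dvd det D"
    using \<open>k \<noteq> l\<close> by (simp add: D_def del: mult_pCons_left mult_pCons_right)
  \<comment> \<open>Multiplying by \<open>det Lp\<close> cancels \<open>det Qp\<close> in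
    \<open>det N * det Qp = det Z * det D\<close>.\<close>
  also have "det D dvd det Z * det D * det Lp"
    by simp
  also have "det Z * det D * det Lp = det N * (det Lp * det Qp)"
    using arg_cong[OF \<open>N ** Qp = Z ** D\<close>, of det] by (simp add: det_mul mult_ac)
  finally show ?thesis
    by (simp add: \<open>det Lp * det Qp = 1\<close> N_def charpoly_def)
qed

section \<open>The second largest eigenvalue of a symmetric matrix\<close>

text \<open>If the second entry were below \<open>b\<close>, then only the first could be at least
  \<open>b\<close>, whereas \<open>a\<close> and \<open>b\<close> count as two such elements even
  when equal.\<close>

lemma second_largest_ge:
  fixes a b :: "'a::linorder"
  assumes "{#a, b#} \<subseteq># X" and "b \<le> a" and s: "s = rev (sorted_list_of_multiset X)"
  shows "2 \<le> length s \<and> b \<le> s ! 1"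
proof -
  have X: "mset s = X"
    by (simp add: s)
  have "size {#a, b#} \<le> size (mset s)"
    unfolding X by (rule size_mset_mono[OF assms(1)])
  then obtain p q r where pqr: "s = p # q # r"
    by (cases s; cases "tl s") auto
  have "sorted (rev s)"
    by (simp add: s)
  then have q: "\<forall>x\<in>set r. x \<le> q"
    by (auto simp: pqr sorted_append)
  have "b \<le> q"
  proof (rule ccontr)
    assume "\<not> b \<le> q"
    then have none: "filter ((\<le>) b) r = []"
      using q by (auto simp: filter_empty_conv)
    have "size (filter_mset ((\<le>) b) X) \<le> 1"
      using \<open>\<not> b \<le> q\<close> by (simp add: X[symmetric] pqr none flip: mset_filter)
    moreover have "size (filter_mset ((\<le>) b) {#a, b#}) \<le> size (filter_mset ((\<le>) b) X)"
      by (intro size_mset_mono multiset_filter_mono assms)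
    ultimately show False
      using \<open>b \<le> a\<close> by simp
  qed
  then show ?thesis
    by (simp add: pqr)
qed

text \<open>Compactness gives a maximizer \<open>w\<close> of the quadratic form on the unit sphere
  of the complement of \<open>v\<close>. Symmetry makes the complement invariant under
  \<open>M\<close>, so the residual \<open>h\<close> is an admissible direction of variation. The
  vector \<open>f\<close> ensures that this sphere is nonempty.\<close>

lemma symmetric_max_on_orthogonal:
  fixes M :: "real ^ 'n ^ 'n"
  assumes sym: "transpose M = M" and v: "M *v v = \<alpha> *\<^sub>R v"
    and f: "v \<bullet> f = 0" "f \<noteq> 0"
  obtains w \<mu> where "norm w = 1" "v \<bullet> w = 0" "M *v w = \<mu> *\<^sub>R w" "f \<bullet> (M *v f) \<le> \<mu> * (f \<bullet> f)"
proof -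
  have adj: "a \<bullet> (M *v b) = (M *v a) \<bullet> b" for a b
    by (metis dot_lmul_matrix sym vector_transpose_matrix)
  define K where "K = {z. v \<bullet> z = 0} \<inter> sphere 0 1"
  define \<phi> where "\<phi> = (\<lambda>z. z \<bullet> (M *v z))"
  have "compact K"
    unfolding K_def by (intro closed_Int_compact closed_hyperplane compact_sphere)
  moreover have unit: "sgn z \<in> K" if "v \<bullet> z = 0" "z \<noteq> 0" for z
    using that by (simp add: K_def sgn_div_norm)
  moreover have "continuous_on K \<phi>"
    unfolding \<phi>_def by (intro continuous_intros)
  ultimately obtain w where w: "w \<in> K" and max: "\<And>z. z \<in> K \<Longrightarrow> \<phi> z \<le> \<phi> w"
    using continuous_attains_sup[of K \<phi>] f by blast
  define \<mu> where "\<mu> = \<phi> w"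
  have norm_w: "norm w = 1" and orth: "v \<bullet> w = 0"
    using w by (auto simp: K_def)
  then have ww: "w \<bullet> w = 1"
    by (simp add: dot_square_norm)
  have bound: "\<phi> z \<le> \<mu> * (z \<bullet> z)" if "v \<bullet> z = 0" for z
  proof (cases "z = 0")
    case False
    have "\<phi> (sgn z) = \<phi> z / (z \<bullet> z)"
      by (simp add: \<phi>_def sgn_div_norm matrix_vector_mult_scaleR dot_square_norm power2_eq_square divide_simps)
    then show ?thesis
      using max[OF unit[OF that False]] False by (simp add: \<mu>_def pos_divide_le_eq)
  qed (simp add: \<phi>_def)
  define h where "h = \<mu> *\<^sub>R w - M *v w"
  have "v \<bullet> h = 0"
    by (simp add: h_def inner_diff_right orth adj v)
  \<comment> \<open>Otherwise moving from \<open>w\<close> in direction \<open>-h\<close> would violate the maximality of \<open>\<mu>\<close>.\<close>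
  have "h = 0"
  proof (rule ccontr)
    assume "h \<noteq> 0"
    define c where "c = \<mu> * (h \<bullet> h) - \<phi> h"
    \<comment> \<open>This \<open>t\<close> solves \<open>h \<bullet> h = - t * (c + 1)\<close>, so
      the linear term \<open>2 * t * (h \<bullet> h)\<close> of the variation outweighs the
      quadratic term with coefficient \<open>c\<close>. The added 1 keeps the denominator
      positive.\<close>
    define t where "t = - (h \<bullet> h) / (c + 1)"
    have "c \<ge> 0"
      using bound[OF \<open>v \<bullet> h = 0\<close>] by (simp add: c_def)
    have hw: "h \<bullet> h = \<mu> * (w \<bullet> h) - w \<bullet> (M *v h)"
      by (simp add: h_def inner_diff_left adj inner_commute)
    have "\<phi> (w + t *\<^sub>R h) \<le> \<mu> * ((w + t *\<^sub>R h) \<bullet> (w + t *\<^sub>R h))"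
      by (intro bound) (simp add: inner_add_right orth \<open>v \<bullet> h = 0\<close>)
    moreover have "\<phi> (w + t *\<^sub>R h) = \<mu> + 2 * t * (w \<bullet> (M *v h)) + t\<^sup>2 * \<phi> h"
      using adj[of w h] by (simp add: \<mu>_def \<phi>_def matrix_vector_right_distrib matrix_vector_mult_scaleR
          inner_add_left inner_add_right power2_eq_square inner_commute algebra_simps)
    moreover have "(w + t *\<^sub>R h) \<bullet> (w + t *\<^sub>R h) = 1 + 2 * t * (w \<bullet> h) + t\<^sup>2 * (h \<bullet> h)"
      by (simp add: inner_add_left inner_add_right ww power2_eq_square inner_commute algebra_simps)
    ultimately have "\<mu> + 2 * t * (w \<bullet> (M *v h)) + t\<^sup>2 * \<phi> h \<le> \<mu> * (1 + 2 * t * (w \<bullet> h) + t\<^sup>2 * (h \<bullet> h))"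
      by (simp only:)
    then have "0 \<le> 2 * t * (\<mu> * (w \<bullet> h) - w \<bullet> (M *v h)) + t\<^sup>2 * c"
      by (simp add: c_def algebra_simps)
    also have "\<dots> = 2 * t * (h \<bullet> h) + t\<^sup>2 * c"
      by (simp add: hw)
    also have "\<dots> = - (t\<^sup>2 * (c + 2))"
    proof -
      have "h \<bullet> h = - t * (c + 1)"
        using \<open>c \<ge> 0\<close> by (simp add: t_def)
      then show ?thesis
        by (simp only: power2_eq_square) (simp add: algebra_simps)
    qed
    also have "\<dots> < 0"
      using \<open>c \<ge> 0\<close> \<open>h \<noteq> 0\<close> by (simp add: t_def)
    finally show False
      by simp
  qed
  then show thesis
    using that[OF norm_w orth, of \<mu>] bound[OF f(1)] by (simp add: h_def \<phi>_def)
qed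

lemma symmetric_second_eigenvalue_bound:
  fixes M :: "real ^ 'n ^ 'n"
  assumes sym: "transpose M = M" and v: "M *v v = v" "v \<noteq> 0"
    and nonneg: "\<And>z. 0 \<le> z \<bullet> (M *v z)" and le: "\<And>z. z \<bullet> (M *v z) \<le> z \<bullet> z"
    and f: "v \<bullet> f = 0" and s: "s = rev (sorted_list_of_multiset (image_mset sqrt (proots (charpoly M))))"
  shows "sqrt (f \<bullet> (M *v f)) \<le> (if 2 \<le> length s then s ! 1 else 0) * norm f"
proof (cases "f = 0")
  \<comment> \<open>Here two eigenvalues are exhibited, so the default \<open>0\<close> can only
    occur for \<open>f = 0\<close>, where both sides vanish.\<close>
  case False
  then obtain w \<mu> where w: "norm w = 1" "v \<bullet> w = 0" "M *v w = \<mu> *\<^sub>R w"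
    and f_le: "f \<bullet> (M *v f) \<le> \<mu> * (f \<bullet> f)"
    using symmetric_max_on_orthogonal[OF sym, of v 1 f] v f by auto
  have "\<mu> \<le> 1"
    using le[of w] w by (simp add: dot_square_norm)
  \<comment> \<open>If all minors vanished, expanding \<open>v $ k * (w \<bullet> w)\<close> would
    give \<open>w $ k * (v \<bullet> w) = 0\<close> for every \<open>k\<close>, hence
    \<open>v = 0\<close>.\<close>
  have "\<exists>k l. v $ k * w $ l \<noteq> v $ l * w $ k"
  proof (rule ccontr)
    assume "\<not> ?thesis"
    then have minors: "v $ k * w $ l = w $ k * v $ l" for k l
      by (metis mult.commute)
    have "v $ k = 0" for k
    proof -
      have "v $ k = v $ k * (w \<bullet> w)"
        using w by (simp add: dot_square_norm)
      also have "\<dots> = w $ k * (v \<bullet> w)"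
        by (simp add: inner_vec_def sum_distrib_left mult.assoc[symmetric] minors) (simp add: mult_ac)
      finally show ?thesis
        using w by simp
    qed
    with v show False
      by (simp add: vec_eq_iff)
  qed
  then have "[:- 1, 1:] * [:- \<mu>, 1:] dvd charpoly M"
    using two_eigenvectors_dvd_charpoly[of M v 1 w \<mu>] v w
    by (auto simp del: mult_pCons_left mult_pCons_right)
  then obtain p where p: "charpoly M = ([:- 1, 1:] * [:- \<mu>, 1:]) * p"
    by (rule dvdE)
  have "proots (charpoly M) = proots [:- 1, 1:] + proots [:- \<mu>, 1:] + proots p"
    using charpoly_nonzero[of M] unfolding p by (subst proots_mult | simp del: mult_pCons_left mult_pCons_right)+
  then have "{#1, \<mu>#} \<subseteq># proots (charpoly M)"
    by (simp only: proots_linear_factor) simp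
  then have "{#1, sqrt \<mu>#} \<subseteq># image_mset sqrt (proots (charpoly M))"
    by (auto dest: image_mset_subseteq_mono[of _ _ sqrt])
  then have "2 \<le> length s \<and> sqrt \<mu> \<le> s ! 1"
    by (rule second_largest_ge[OF _ _ s]) (simp add: \<open>\<mu> \<le> 1\<close>)
  moreover have "sqrt (f \<bullet> (M *v f)) \<le> sqrt \<mu> * norm f"
    using f_le by (metis norm_eq_sqrt_inner real_sqrt_le_mono real_sqrt_mult)
  moreover have "sqrt \<mu> * norm f \<le> s ! 1 * norm f" if "sqrt \<mu> \<le> s ! 1"
    using that by (rule mult_right_mono) simp
  ultimately show ?thesis
    by simp
qed simp

section \<open>Bilinear forms and the second singular value\<close>

text \<open>Depending on which Gram matrix is the smaller one, the spectral bound controls either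
  \<open>A *v f\<close> or \<open>g v* A\<close>; by adjointness and Cauchy-Schwarz, either one
  suffices.\<close>

lemma second_singular_value_bound:
  fixes A :: "real ^ 'n ^ 'm"
  assumes u: "A *v v = u" and v: "u v* A = v" and "v \<noteq> 0"
    and contr: "\<And>z. norm (A *v z) \<le> norm z"
    and f: "v \<bullet> f = 0" and g: "u \<bullet> g = 0"
  shows "\<bar>g \<bullet> (A *v f)\<bar> \<le> second_singular_value A * (norm g * norm f)"
proof -
  note adj = dot_lmul_matrix[of _ A, symmetric]
  have contr_adj: "norm (z v* A) \<le> norm z" for z
  proof -
    let ?z = "z v* A"
    have "(norm ?z)\<^sup>2 = z \<bullet> (A *v ?z)"
      by (simp add: adj dot_square_norm)
    also have "\<dots> \<le> norm z * norm ?z"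
      by (rule order_trans[OF norm_cauchy_schwarz mult_left_mono[OF contr]]) simp
    finally show ?thesis
      by (cases "?z = 0") (auto simp: power2_eq_square)
  qed
  have gram: "z \<bullet> ((transpose A ** A) *v z) = (norm (A *v z))\<^sup>2" for z
    using adj[of "A *v z" z] by (simp add: matrix_vector_mul_assoc[symmetric] inner_commute dot_square_norm)
  have gram_adj: "z \<bullet> ((A ** transpose A) *v z) = (norm (z v* A))\<^sup>2" for z
    by (simp add: matrix_vector_mul_assoc[symmetric] adj dot_square_norm)
  show ?thesis
  proof (cases "CARD('n) \<le> CARD('m)")
    case True
    have gram_v: "(transpose A ** A) *v v = v"
      by (simp add: u v matrix_vector_mul_assoc[symmetric])
    have "sqrt (f \<bullet> ((transpose A ** A) *v f)) \<le> second_singular_value A * norm f"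
      unfolding second_singular_value_def Let_def singular_values_def if_P[OF True]
      by (rule symmetric_second_eigenvalue_bound[of _ v])
        (use gram_v \<open>v \<noteq> 0\<close> f contr in \<open>simp_all add: matrix_transpose_mul gram dot_square_norm power_mono\<close>)
    then have "norm (A *v f) \<le> second_singular_value A * norm f"
      by (simp add: gram)
    then have "norm g * norm (A *v f) \<le> norm g * (second_singular_value A * norm f)"
      by (intro mult_left_mono) auto
    then show ?thesis
      using Cauchy_Schwarz_ineq2[of g "A *v f"] by (simp add: mult_ac)
  next
    case False
    have "u \<noteq> 0"
      using v \<open>v \<noteq> 0\<close> by auto
    have gram_u: "(A ** transpose A) *v u = u"
      by (simp add: u v matrix_vector_mul_assoc[symmetric])
    have "sqrt (g \<bullet> ((A ** transpose A) *v g)) \<le> second_singular_value A * norm g"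
      unfolding second_singular_value_def Let_def singular_values_def if_not_P[OF False]
      by (rule symmetric_second_eigenvalue_bound[of _ u])
        (use gram_u \<open>u \<noteq> 0\<close> g contr_adj in \<open>simp_all add: matrix_transpose_mul gram_adj dot_square_norm power_mono\<close>)
    then have "norm (g v* A) \<le> second_singular_value A * norm g"
      by (simp add: gram_adj)
    then have "norm (g v* A) * norm f \<le> second_singular_value A * norm g * norm f"
      by (intro mult_right_mono) auto
    then show ?thesis
      using Cauchy_Schwarz_ineq2[of "g v* A" f] by (simp add: adj mult_ac)
  qed
qed

text \<open>Cauchy-Schwarz with weights \<open>v\<close>: in each row the first factor sums to
  \<open>u $ i\<close> by \<open>A *v v = u\<close>, and summing over the rows,
  \<open>u v* A = v\<close> cancels the weight \<open>v $ j\<close> in the second.\<close>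

lemma schur_test:
  fixes A :: "real ^ 'n ^ 'm"
  assumes nonneg: "\<And>i j. 0 \<le> A $ i $ j" and pos: "\<And>j. 0 < v $ j"
    and u: "A *v v = u" and v: "u v* A = v"
  shows "norm (A *v f) \<le> norm f"
proof -
  have "((A *v f) $ i)\<^sup>2 \<le> (\<Sum>j\<in>UNIV. u $ i * A $ i $ j * ((f $ j)\<^sup>2 / v $ j))" for i
  proof -
    have "(A *v f) $ i = (\<Sum>j\<in>UNIV. sqrt (A $ i $ j * v $ j) * (sqrt (A $ i $ j / v $ j) * f $ j))"
      using nonneg pos by (simp add: matrix_vector_mult_def real_sqrt_mult real_sqrt_divide
          less_imp_neq[symmetric] mult.assoc[symmetric])
    then have "((A *v f) $ i)\<^sup>2 \<le> (\<Sum>j\<in>UNIV. (sqrt (A $ i $ j * v $ j))\<^sup>2)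
        * (\<Sum>j\<in>UNIV. (sqrt (A $ i $ j / v $ j) * f $ j)\<^sup>2)"
      by (simp only: Cauchy_Schwarz_ineq_sum)
    also have "\<dots> = u $ i * (\<Sum>j\<in>UNIV. A $ i $ j / v $ j * (f $ j)\<^sup>2)"
      using nonneg pos by (simp add: u[symmetric] matrix_vector_mult_def power_mult_distrib less_imp_le)
    finally show ?thesis
      by (simp add: sum_distrib_left mult.assoc)
  qed
  then have "(norm (A *v f))\<^sup>2 \<le> (\<Sum>i\<in>UNIV. \<Sum>j\<in>UNIV. u $ i * A $ i $ j * ((f $ j)\<^sup>2 / v $ j))"
    by (simp add: norm_vec_def L2_set_def sum_nonneg sum_mono)
  also have "\<dots> = (\<Sum>j\<in>UNIV. (\<Sum>i\<in>UNIV. u $ i * A $ i $ j) * ((f $ j)\<^sup>2 / v $ j))"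
    by (subst sum.swap) (simp only: sum_distrib_right)
  also have "\<dots> = (\<Sum>j\<in>UNIV. (u v* A) $ j * ((f $ j)\<^sup>2 / v $ j))"
    by (simp add: vector_matrix_mult_def mult.commute)
  also have "\<dots> = (norm f)\<^sup>2"
    using pos by (simp add: v norm_vec_def L2_set_def sum_nonneg less_imp_neq[symmetric])
  finally show ?thesis
    by (simp add: power2_le_iff_abs_le)
qed

text \<open>Subtracting the projections onto \<open>u\<close> and \<open>v\<close> turns the
  deviation into \<open>g \<bullet> (A *v f)\<close>, because \<open>A\<close> and its adjoint
  exchange \<open>v\<close> and \<open>u\<close>, which have equal norms. The factors under the root
  are the squared norms of \<open>g\<close> and \<open>f\<close> by Pythagoras.\<close>

lemma second_singular_value_deviation:
  fixes A :: "real ^ 'n ^ 'm"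
  assumes nonneg: "\<And>i j. 0 \<le> A $ i $ j" and pos: "\<And>j. 0 < v $ j"
    and u: "A *v v = u" and v: "u v* A = v"
  shows "\<bar>a \<bullet> (A *v b) - (a \<bullet> u) * (v \<bullet> b) / (v \<bullet> v)\<bar>
    \<le> second_singular_value A
      * sqrt (((norm a)\<^sup>2 - (a \<bullet> u)\<^sup>2 / (v \<bullet> v)) * ((norm b)\<^sup>2 - (v \<bullet> b)\<^sup>2 / (v \<bullet> v)))"
proof -
  note adj = dot_lmul_matrix[of _ A, symmetric]
  have uu: "u \<bullet> u = v \<bullet> v"
    using adj[of u v] unfolding u v .
  have "v \<noteq> 0"
    using pos by (metis less_irrefl zero_index)
  define g where "g = a - ((a \<bullet> u) / (v \<bullet> v)) *\<^sub>R u"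
  define f where "f = b - ((v \<bullet> b) / (v \<bullet> v)) *\<^sub>R v"
  have "u \<bullet> g = 0" "v \<bullet> f = 0"
    using \<open>v \<noteq> 0\<close> by (simp_all add: f_def g_def inner_diff_right uu inner_commute)
  then have "\<bar>g \<bullet> (A *v f)\<bar> \<le> second_singular_value A * (norm g * norm f)"
    by (intro second_singular_value_bound[OF u v \<open>v \<noteq> 0\<close> schur_test[OF nonneg pos u v]])
  moreover have "g \<bullet> (A *v f) = a \<bullet> (A *v b) - (a \<bullet> u) * (v \<bullet> b) / (v \<bullet> v)"
    using \<open>v \<noteq> 0\<close> by (simp add: f_def g_def inner_diff_left inner_diff_right matrix_vector_mult_diff_distrib
        matrix_vector_mult_scaleR u v uu adj[of u b] field_simps)
  moreover have "(norm g)\<^sup>2 = (norm a)\<^sup>2 - (a \<bullet> u)\<^sup>2 / (v \<bullet> v)"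
    unfolding g_def power2_norm_eq_inner
    using \<open>v \<noteq> 0\<close> by (simp add: inner_diff_left inner_diff_right uu
        inner_commute[of u a] power2_eq_square)
  moreover have "(norm f)\<^sup>2 = (norm b)\<^sup>2 - (v \<bullet> b)\<^sup>2 / (v \<bullet> v)"
    unfolding f_def power2_norm_eq_inner
    using \<open>v \<noteq> 0\<close> by (simp add: inner_diff_left inner_diff_right
        inner_commute[of b v] power2_eq_square)
  moreover have "norm g * norm f = sqrt ((norm g)\<^sup>2 * (norm f)\<^sup>2)"
    by (simp add: real_sqrt_mult)
  ultimately show ?thesis
    by simp
qed

section \<open>Diagonal scaling\<close>

lemma diag_powr_mult_vector: "(diag_powr D a *v z) $ i = (D $ i $ i) powr a * z $ i"
  by (simp add: matrix_vector_mult_def diag_powr_def if_distrib if_distribR cong: if_cong)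

lemma diagonal_matrix_mult_vector:
  assumes "diagonal_matrix D"
  shows "(D *v z) $ i = D $ i $ i * z $ i"
proof -
  have "(D *v z) $ i = (\<Sum>j\<in>UNIV. if j = i then D $ i $ i * z $ i else 0)"
    unfolding matrix_vector_mult_def vec_lambda_beta
    by (rule sum.cong) (use assms in \<open>auto simp: diagonal_matrix_def\<close>)
  then show ?thesis
    by simp
qed

lemma vector_mult_diagonal_matrix:
  assumes "diagonal_matrix D"
  shows "z v* D = D *v z"
proof -
  have "transpose D = D"
    using assms unfolding diagonal_matrix_def transpose_def vec_eq_iff vec_lambda_beta by metis
  then show ?thesis
    by (metis transpose_matrix_vector)
qed

lemma diagonal_diag_powr: "diagonal_matrix (diag_powr D a)"
  by (simp add: diagonal_matrix_def diag_powr_def)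

lemma diag_powr_add: "diag_powr D a *v (diag_powr D b *v z) = diag_powr D (a + b) *v z"
  by (simp add: vec_eq_iff diag_powr_mult_vector powr_add)

lemma diag_powr_0:
  assumes "\<And>i. 0 < D $ i $ i"
  shows "diag_powr D 0 *v z = z"
  using assms by (simp add: vec_eq_iff diag_powr_mult_vector less_imp_neq[symmetric])

lemma diag_powr_1:
  assumes "diagonal_matrix D" "\<And>i. 0 < D $ i $ i"
  shows "diag_powr D 1 = D"
  using assms by (auto simp: vec_eq_iff diag_powr_def diagonal_matrix_def less_imp_le)

lemma inner_diag_powr_mult: "(diag_powr D a *v p) \<bullet> q = p \<bullet> (diag_powr D a *v q)"
  by (simp add: inner_vec_def diag_powr_mult_vector mult_ac)

text \<open>Source of the positive diagonals: applied to \<open>B\<close> and \<open>x\<close> for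
  \<open>R\<close>, and to \<open>transpose B\<close> and \<open>y\<close> for
  \<open>C\<close>.\<close>

lemma nonneg_matrix_mult_pos:
  fixes B :: "real ^ 'n ^ 'm"
  assumes "\<And>i j. 0 \<le> B $ i $ j" "row i B \<noteq> 0" "\<And>j. 0 < x $ j"
  shows "0 < (B *v x) $ i"
proof -
  obtain j where "B $ i $ j \<noteq> 0"
    using assms(2) by (auto simp: vec_eq_iff row_def)
  then have "0 < B $ i $ j * x $ j"
    using assms(1)[of i j] assms(3)[of j] by simp
  then show ?thesis
    unfolding matrix_vector_mult_def vec_lambda_beta
    by (rule sum_pos2[rotated 2]) (use assms(1,3) in \<open>auto intro!: mult_nonneg_nonneg intro: less_imp_le\<close>)
qed

theorem theorem9:
  fixes B :: "real ^ 'n ^ 'm"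
    and x :: "real ^ 'n" and y :: "real ^ 'm"
    and R :: "real ^ 'm ^ 'm" and C :: "real ^ 'n ^ 'n"
    and S :: "'m set" and T :: "'n set"
  assumes "\<And>i j. 0 \<le> B $ i $ j"
    and "\<And>i. row i B \<noteq> 0"
    and "\<And>j. column j B \<noteq> 0"
    and "\<And>j. 0 < x $ j"
    and "\<And>i. 0 < y $ i"
    and "diagonal_matrix R"
    and "diagonal_matrix C"
    and "B *v x = R *v y"
    and "y v* B = x v* C"
  shows "\<bar>char_vec S \<bullet> (B *v char_vec T)
           - (char_vec S \<bullet> (B *v x)) * (y \<bullet> (B *v char_vec T)) / (y \<bullet> (B *v x))\<bar>
         \<le> second_singular_value (diag_powr R (-1/2) ** B ** diag_powr C (-1/2))
           * sqrt (((norm (diag_powr R (1/2) *v char_vec S))\<^sup>2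
                      - (char_vec S \<bullet> (B *v x))\<^sup>2 / (y \<bullet> (B *v x)))
                 * ((norm (diag_powr C (1/2) *v char_vec T))\<^sup>2
                      - (y \<bullet> (B *v char_vec T))\<^sup>2 / (y \<bullet> (B *v x))))"
proof -
  note nonneg = assms(1) and x_pos = assms(4) and y_pos = assms(5)
    and R = assms(6) and C = assms(7) and Bx = assms(8) and yB = assms(9)
  have BTy: "y v* B = C *v x"
    by (simp add: yB vector_mult_diagonal_matrix C)
  note adj = dot_lmul_matrix[symmetric]
  have R_pos: "0 < R $ i $ i" for i
    using nonneg_matrix_mult_pos[of B i x] assms y_pos[of i]
    by (simp add: diagonal_matrix_mult_vector zero_less_mult_iff not_less_iff_gr_or_eq)
  have C_pos: "0 < C $ j $ j" for j
  proof -
    have "0 < (transpose B *v y) $ j"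
      by (rule nonneg_matrix_mult_pos) (use assms in \<open>auto simp: transpose_def row_def column_def\<close>)
    then show ?thesis
      using x_pos[of j] by (simp add: BTy diagonal_matrix_mult_vector C zero_less_mult_iff not_less_iff_gr_or_eq)
  qed
  note diag = matrix_vector_mul_assoc[symmetric] diag_powr_add inner_diag_powr_mult
    diag_powr_0[of R, OF R_pos] diag_powr_0[of C, OF C_pos]
    diag_powr_1[OF R R_pos] diag_powr_1[OF C C_pos]
  define A where "A = diag_powr R (-1/2) ** B ** diag_powr C (-1/2)"
  define u where "u = diag_powr R (1/2) *v y"
  define v where "v = diag_powr C (1/2) *v x"
  define a where "a = diag_powr R (1/2) *v char_vec S"
  define b where "b = diag_powr C (1/2) *v char_vec T"
  have "A $ i $ j = (R $ i $ i) powr (-1/2) * B $ i $ j * (C $ j $ j) powr (-1/2)" for i j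
    by (simp add: A_def matrix_matrix_mult_def diag_powr_def if_distrib if_distribR cong: if_cong)
  then have A_nonneg: "0 \<le> A $ i $ j" for i j
    by (simp add: nonneg)
  have v_pos: "0 < v $ j" for j
    using C_pos[of j] x_pos[of j] by (simp add: v_def diag_powr_mult_vector)
  \<comment> \<open>Written as first powers, \<open>R\<close> and \<open>C\<close> combine with the
    exponents \<open>-1/2\<close> to leave \<open>1/2\<close>, as needed for \<open>u\<close> and
    \<open>v\<close>.\<close>
  have "R *v y = diag_powr R 1 *v y" "C *v x = diag_powr C 1 *v x"
    by (simp_all add: diag)
  then have "A *v v = u" "u v* A = v"
    by (simp_all add: A_def u_def v_def matrix_vector_mul_assoc[symmetric] vector_matrix_mul_assoc[symmetric]
        vector_mult_diagonal_matrix diagonal_diag_powr diag_powr_add diag_powr_0 R_pos C_pos Bx BTy)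
  from second_singular_value_deviation[OF A_nonneg v_pos this, of a b]
  have "\<bar>a \<bullet> (A *v b) - (a \<bullet> u) * (v \<bullet> b) / (v \<bullet> v)\<bar>
    \<le> second_singular_value A
      * sqrt (((norm a)\<^sup>2 - (a \<bullet> u)\<^sup>2 / (v \<bullet> v)) * ((norm b)\<^sup>2 - (v \<bullet> b)\<^sup>2 / (v \<bullet> v)))" .
  moreover have "a \<bullet> (A *v b) = char_vec S \<bullet> (B *v char_vec T)"
    by (simp add: a_def b_def A_def diag)
  moreover have "a \<bullet> u = char_vec S \<bullet> (B *v x)"
    by (simp add: a_def u_def diag Bx)
  \<comment> \<open>Both sides equal the inner product of \<open>C *v x\<close> with
    \<open>char_vec T\<close>.\<close>
  moreover have "v \<bullet> b = y \<bullet> (B *v char_vec T)"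
    unfolding adj BTy by (simp add: v_def b_def diag) (simp add: inner_vec_def diagonal_matrix_mult_vector C mult_ac)
  moreover have "v \<bullet> v = y \<bullet> (B *v x)"
    unfolding adj BTy by (simp add: v_def diag inner_commute)
  ultimately show ?thesis
    by (simp add: A_def a_def b_def)
qed

end
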